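(* For any $\mathbf{IL}_{\mathrm{set}}$-frame $F=\langle W,R,S\rangle$, we have $F\models\mathsf{M_0}$ if and only if $F$ is an $\mathbf{IL}_{\mathrm{set}}\mathsf{M_0}$-frame, where $\mathsf{M_0}$ is the schema $(A\rhd B)\rightarrow\bigl((\Diamond A\wedge\Box C)\rhd(B\wedge\Box C)\bigr)$.
   Context: Modal formulas are built from $\bot$ and countably many propositional variables using $\rightarrow$, the unary modality $\Box$ and the binary modality $\rhd$; other boolean connectives are defined as usual and $\Diamond A:=\neg\Box\neg A$. An $\mathbf{IL}_{\mathrm{set}}$-frame is a structure $\langle W,R,S\rangle$ where $W$ is a non-empty set, $R$ is a transitive and conversely well-founded binary relation on $W$ (every non-empty subset of $W$ has an $R$-maximal element), and $S\subseteq W\times W\times(\mathcal P(W)\setminus\{\emptyset\})$ satisfies, writing $yS_xY$ for $(x,y,Y)\in S$: (a) if $xS_wY$ then $wRx$ and $wRy$ for all $y\in Y$; (b) $wRx$ implies $xS_w\{x\}$; (c) if $xS_wY$, then for all $y\in Y$ and all $Z$: if $y\notin Z$ and $yS_wZ$ then $xS_wZ$; (d) $wRx$ and $xRy$ imply $xS_w\{y\}$. An $\mathbf{IL}_{\mathrm{set}}$-model based on such a frame is obtained by adding a relation $\Vdash$ between worlds and formulas that commutes with boolean connectives and satisfies: $w\Vdash\Box A$ iff $x\Vdash A$ for all $x$ with $wRx$; $w\Vdash A\rhd B$ iff for all $x$ with $wRx$ and $x\Vdash A$ there is $Y$ with $xS_wY$ and $y\Vdash B$ for all $y\in Y$. For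 a schema $\mathsf X$, $F\models\mathsf X$ means that every instance of $\mathsf X$ is true at every world of every model based on $F$. An $\mathbf{IL}_{\mathrm{set}}\mathsf{M_0}$-frame is an $\mathbf{IL}_{\mathrm{set}}$-frame such that for all $w,x,y\in W$ and $Y\subseteq W$ with $wRx$, $xRy$ and $yS_wY$ there exists $Y'\subseteq Y$ such that $xS_wY'$ and, for all $y'\in Y'$ and all $z$, $y'Rz$ implies $xRz$. *)

theory Defs
  imports Main
begin

datatype fm =
    Bot  ("\<^bold>\<bottom>")
  | Var nat
  | Imp fm fm  (infixr "\<^bold>\<rightarrow>" 55)
  | Box fm  ("\<^bold>\<box> _" [80] 80)
  | Rhd fm fm  (infix "\<rhd>" 65)

abbreviation Neg :: "fm \<Rightarrow> fm"  ("\<^bold>\<not> _" [80] 80)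
  where "\<^bold>\<not> A \<equiv> A \<^bold>\<rightarrow> \<^bold>\<bottom>"

abbreviation Con :: "fm \<Rightarrow> fm \<Rightarrow> fm"  (infixr "\<^bold>\<and>" 70)
  where "A \<^bold>\<and> B \<equiv> \<^bold>\<not> (A \<^bold>\<rightarrow> \<^bold>\<not> B)"

abbreviation Dia :: "fm \<Rightarrow> fm"  ("\<^bold>\<diamond> _" [80] 80)
  where "\<^bold>\<diamond> A \<equiv> \<^bold>\<not> \<^bold>\<box> \<^bold>\<not> A"

text \<open>
  A frame is given by a carrier \<open>W\<close>, a relation \<open>R\<close> on \<open>W\<close>, and a set \<open>S\<close> of triples;
  \<open>(w, x, Y) \<in> S\<close> is written \<open>x S\<^sub>w Y\<close> on paper.  Since \<open>R \<subseteq> W \<times> W\<close>, well-foundedness of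
  the converse says that every non-empty subset of \<open>W\<close> has an \<open>R\<close>-maximal element.
  Clause (c) is the variant of quasi-transitivity that works with a single \<open>y \<in> Y\<close>;
  \<open>S\<close> is not assumed to be monotone in its last argument.
\<close>

definition ILset_frame ::
  "'w set \<Rightarrow> ('w \<times> 'w) set \<Rightarrow> ('w \<times> 'w \<times> 'w set) set \<Rightarrow> bool"
where
  "ILset_frame W R S \<longleftrightarrow>
     W \<noteq> {} \<and>
     R \<subseteq> W \<times> W \<and> trans R \<and> wf (R\<inverse>) \<and>
     S \<subseteq> W \<times> W \<times> (Pow W - {{}}) \<and>
     (\<forall>w x Y. (w, x, Y) \<in> S \<longrightarrow> (w, x) \<in> R \<and> (\<forall>y\<in>Y. (w, y) \<in> R)) \<and>
     (\<forall>w x. (w, x) \<in> R \<longrightarrow> (w, x, {x}) \<in> S) \<and>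
     (\<forall>w x Y. (w, x, Y) \<in> S \<longrightarrow>
        (\<forall>y\<in>Y. \<forall>Z. y \<notin> Z \<and> (w, y, Z) \<in> S \<longrightarrow> (w, x, Z) \<in> S)) \<and>
     (\<forall>w x y. (w, x) \<in> R \<and> (x, y) \<in> R \<longrightarrow> (w, x, {y}) \<in> S)"

text \<open>
  A model is a frame together with a forcing relation.  The relation is constrained only at
  worlds of \<open>W\<close>; its values outside \<open>W\<close> are irrelevant.
\<close>

definition ILset_model ::
  "'w set \<Rightarrow> ('w \<times> 'w) set \<Rightarrow> ('w \<times> 'w \<times> 'w set) set \<Rightarrow> ('w \<Rightarrow> fm \<Rightarrow> bool) \<Rightarrow> bool"
where
  "ILset_model W R S forces \<longleftrightarrow>
     ILset_frame W R S \<and>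
     (\<forall>w\<in>W.
        \<not> forces w \<^bold>\<bottom> \<and>
        (\<forall>A B. forces w (A \<^bold>\<rightarrow> B) \<longleftrightarrow> (forces w A \<longrightarrow> forces w B)) \<and>
        (\<forall>A. forces w (\<^bold>\<box> A) \<longleftrightarrow> (\<forall>x. (w, x) \<in> R \<longrightarrow> forces x A)) \<and>
        (\<forall>A B. forces w (A \<rhd> B) \<longleftrightarrow>
           (\<forall>x. (w, x) \<in> R \<and> forces x A \<longrightarrow>
              (\<exists>Y. (w, x, Y) \<in> S \<and> (\<forall>y\<in>Y. forces y B)))))"

text \<open>A schema is represented by the set of its instances.\<close>

definition frame_validates ::
  "'w set \<Rightarrow> ('w \<times> 'w) set \<Rightarrow> ('w \<times> 'w \<times> 'w set) set \<Rightarrow> fm set \<Rightarrow> bool"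
where
  "frame_validates W R S X \<longleftrightarrow>
     (\<forall>forces. ILset_model W R S forces \<longrightarrow> (\<forall>w\<in>W. \<forall>A\<in>X. forces w A))"

definition M0 :: "fm set" where
  "M0 = {(A \<rhd> B) \<^bold>\<rightarrow> ((\<^bold>\<diamond> A \<^bold>\<and> \<^bold>\<box> C) \<rhd> (B \<^bold>\<and> \<^bold>\<box> C)) | A B C. True}"

definition ILset_M0_frame ::
  "'w set \<Rightarrow> ('w \<times> 'w) set \<Rightarrow> ('w \<times> 'w \<times> 'w set) set \<Rightarrow> bool"
where
  "ILset_M0_frame W R S \<longleftrightarrow>
     ILset_frame W R S \<and>
     (\<forall>w\<in>W. \<forall>x\<in>W. \<forall>y\<in>W. \<forall>Y. Y \<subseteq> W \<and> (w, x) \<in> R \<and> (x, y) \<in> R \<and> (w, y, Y) \<in> S \<longrightarrow>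
        (\<exists>Y'. Y' \<subseteq> Y \<and> (w, x, Y') \<in> S \<and>
           (\<forall>y'\<in>Y'. \<forall>z. (y', z) \<in> R \<longrightarrow> (x, z) \<in> R)))"

end

theory Submission imports Defs begin

text \<open>
  Completeness direction: given \<open>w R x R y S\<^sub>w Y\<close>, let one variable hold at \<open>y\<close> only, one exactly
  on \<open>Y\<close>, and one exactly on the \<open>R\<close>-successors of \<open>x\<close>.  The instance of \<open>M\<^sub>0\<close> for these
  variables, evaluated at \<open>w\<close>, yields the required \<open>Y' \<subseteq> Y\<close>.
\<close>

text \<open>A model carries forcing on all formulas, not just a valuation. Recursion on formulas
  extends any \<open>V\<close> to such a relation, so the variables can be prescribed
  freely.\<close>

primrec sat ::
  "('w \<times> 'w) set \<Rightarrow> ('w \<times> 'w \<times> 'w set) set \<Rightarrow> (nat \<Rightarrow> 'w set) \<Rightarrow> 'w \<Rightarrow> fm \<Rightarrow> bool"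
where
  "sat R S V w \<^bold>\<bottom> \<longleftrightarrow> False"
| "sat R S V w (Var n) \<longleftrightarrow> w \<in> V n"
| "sat R S V w (A \<^bold>\<rightarrow> B) \<longleftrightarrow> (sat R S V w A \<longrightarrow> sat R S V w B)"
| "sat R S V w (\<^bold>\<box> A) \<longleftrightarrow> (\<forall>x. (w, x) \<in> R \<longrightarrow> sat R S V x A)"
| "sat R S V w (A \<rhd> B) \<longleftrightarrow>
     (\<forall>x. (w, x) \<in> R \<and> sat R S V x A \<longrightarrow> (\<exists>Y. (w, x, Y) \<in> S \<and> (\<forall>y\<in>Y. sat R S V y B)))"

lemma ILset_model_sat:
  assumes "ILset_frame W R S"
  shows "ILset_model W R S (sat R S V)"
  using assms by (simp add: ILset_model_def)

lemma ILset_frameD: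
  assumes "ILset_frame W R S"
  shows "R \<subseteq> W \<times> W" "trans R" "S \<subseteq> W \<times> W \<times> (Pow W - {{}})"
  using assms by (simp_all add: ILset_frame_def)

lemma ILset_modelD:
  assumes "ILset_model W R S forces" and "w \<in> W"
  shows "\<not> forces w \<^bold>\<bottom>"
    and "forces w (A \<^bold>\<rightarrow> B) \<longleftrightarrow> (forces w A \<longrightarrow> forces w B)"
    and "forces w (\<^bold>\<box> A) \<longleftrightarrow> (\<forall>x. (w, x) \<in> R \<longrightarrow> forces x A)"
    and "forces w (A \<rhd> B) \<longleftrightarrow>
      (\<forall>x. (w, x) \<in> R \<and> forces x A \<longrightarrow> (\<exists>Y. (w, x, Y) \<in> S \<and> (\<forall>y\<in>Y. forces y B)))"
  using assms by (simp_all add: ILset_model_def)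

lemma M0_frame_forces_M0:
  assumes frame: "ILset_M0_frame W R S" and model: "ILset_model W R S forces" and "w \<in> W"
  shows "forces w ((A \<rhd> B) \<^bold>\<rightarrow> ((\<^bold>\<diamond> A \<^bold>\<and> \<^bold>\<box> C) \<rhd> (B \<^bold>\<and> \<^bold>\<box> C)))"
proof -
  have F: "ILset_frame W R S"
    and M0: "\<And>w x y Y. \<lbrakk>w \<in> W; x \<in> W; y \<in> W; Y \<subseteq> W; (w, x) \<in> R; (x, y) \<in> R; (w, y, Y) \<in> S\<rbrakk>
      \<Longrightarrow> \<exists>Y'\<subseteq>Y. (w, x, Y') \<in> S \<and> (\<forall>y'\<in>Y'. \<forall>z. (y', z) \<in> R \<longrightarrow> (x, z) \<in> R)"
    using frame by (auto simp: ILset_M0_frame_def)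
  note sub = ILset_frameD[OF F] and m = ILset_modelD[OF model]
  have "\<exists>Y'. (w, x, Y') \<in> S \<and> (\<forall>y\<in>Y'. forces y (B \<^bold>\<and> \<^bold>\<box> C))"
    if rhd: "forces w (A \<rhd> B)" and wx: "(w, x) \<in> R" and x: "forces x (\<^bold>\<diamond> A \<^bold>\<and> \<^bold>\<box> C)" for x
  proof -
    \<comment> \<open>Forcing obeys its clauses only inside \<open>W\<close>, so membership in
      \<open>W\<close> is recorded for each world met.\<close>
    have xW: "x \<in> W" using wx sub(1) by blast
    with x have "\<not> forces x (\<^bold>\<box> (\<^bold>\<not> A))" and boxC: "\<forall>z. (x, z) \<in> R \<longrightarrow> forces z C"
      by (simp_all add: m)
    then obtain y where xy: "(x, y) \<in> R" and "\<not> forces y (\<^bold>\<not> A)" using xW m(3) by blast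
    moreover have yW: "y \<in> W" using xy sub(1) by blast
    ultimately have "forces y A" by (simp add: m)
    \<comment> \<open>Transitivity brings \<open>y\<close> within the scope of
      \<open>A \<rhd> B\<close> at \<open>w\<close>.\<close>
    moreover have "(w, y) \<in> R" using wx xy sub(2) by (rule transD[rotated])
    ultimately obtain Y where Y: "(w, y, Y) \<in> S" and YB: "\<forall>y\<in>Y. forces y B"
      using rhd m(4)[OF \<open>w \<in> W\<close>] by blast
    have YW: "Y \<subseteq> W" using Y sub(3) by blast
    obtain Y' where "Y' \<subseteq> Y" and S: "(w, x, Y') \<in> S"
      and z: "\<forall>y'\<in>Y'. \<forall>z. (y', z) \<in> R \<longrightarrow> (x, z) \<in> R"
      using M0[OF \<open>w \<in> W\<close> xW yW YW wx xy Y] by blast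
    have "forces y' (B \<^bold>\<and> \<^bold>\<box> C)" if "y' \<in> Y'" for y'
    proof -
      have "y' \<in> W" "forces y' B" using that \<open>Y' \<subseteq> Y\<close> YW YB by blast+
      moreover have "\<forall>z. (y', z) \<in> R \<longrightarrow> forces z C" using that z boxC by blast
      ultimately show ?thesis by (simp add: m)
    qed
    with S show ?thesis by blast
  qed
  then show ?thesis using m(2,4)[OF \<open>w \<in> W\<close>] by blast
qed

lemma validates_M0_imp_M0_frame:
  assumes F: "ILset_frame W R S" and valid: "frame_validates W R S M0"
  shows "ILset_M0_frame W R S"
  unfolding ILset_M0_frame_def
proof (intro conjI ballI allI impI F, elim conjE)
  fix w x y Y
  assume "w \<in> W" and wx: "(w, x) \<in> R" and xy: "(x, y) \<in> R" and Y: "(w, y, Y) \<in> S"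
  \<comment> \<open>All indices from 2 on share the last value; only \<open>Var 2\<close> is used
    among them.\<close>
  define V where "V = (\<lambda>n::nat. if n = 0 then {y} else if n = 1 then Y else R `` {x})"
  let ?A = "Var 0" and ?B = "Var 1" and ?C = "Var 2"
  have "sat R S V w ((?A \<rhd> ?B) \<^bold>\<rightarrow> ((\<^bold>\<diamond> ?A \<^bold>\<and> \<^bold>\<box> ?C) \<rhd> (?B \<^bold>\<and> \<^bold>\<box> ?C)))"
    using valid ILset_model_sat[OF F] \<open>w \<in> W\<close> unfolding frame_validates_def M0_def by blast
  \<comment> \<open>The only world forcing \<open>?A\<close> is \<open>y\<close>, and
    \<open>Y\<close> itself answers it.\<close>
  moreover have "sat R S V w (?A \<rhd> ?B)" using Y by (auto simp: V_def)
  moreover have "sat R S V x (\<^bold>\<diamond> ?A \<^bold>\<and> \<^bold>\<box> ?C)" using xy by (simp add: V_def)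
  ultimately obtain Y' where "(w, x, Y') \<in> S" and "\<forall>y'\<in>Y'. sat R S V y' (?B \<^bold>\<and> \<^bold>\<box> ?C)"
    \<comment> \<open>Only the implication and its consequent are opened at \<open>w\<close>; the
      antecedent and the formula at \<open>x\<close> stay folded, so that they match the two facts
      above.\<close>
    using wx unfolding sat.simps(3)[of R S V w] sat.simps(5)[of R S V w "\<^bold>\<diamond> ?A \<^bold>\<and> \<^bold>\<box> ?C"] by blast
  then show "\<exists>Y'\<subseteq>Y. (w, x, Y') \<in> S \<and> (\<forall>y'\<in>Y'. \<forall>z. (y', z) \<in> R \<longrightarrow> (x, z) \<in> R)"
    by (intro exI[of _ Y']) (auto simp: V_def)
qed

theorem lemma3p6:
  fixes W :: "'w set" and R :: "('w \<times> 'w) set" and S :: "('w \<times> 'w \<times> 'w set) set"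
  assumes "ILset_frame W R S"
  shows "frame_validates W R S M0 \<longleftrightarrow> ILset_M0_frame W R S"
proof
  assume "frame_validates W R S M0"
  with assms show "ILset_M0_frame W R S" by (rule validates_M0_imp_M0_frame)
next
  assume "ILset_M0_frame W R S"
  then show "frame_validates W R S M0"
    unfolding frame_validates_def M0_def by (auto intro: M0_frame_forces_M0 simp del: fm.inject)
qed

end
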